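(* Let $G$ be a torsion-free abelian group (written additively) and let $X$ be a non-empty finite subset of $G$. Let $k$ and $l$ be non-zero integers with distinct absolute values. Then $|k\cdot X+l\cdot X| \ge 3|X|-2$.
   Context: For an integer $k$ and a subset $X$ of an additively written group, the dilate $k\cdot X$ is the set $k\cdot X=\{kx : x\in X\}$. For subsets $A,B$ of the group, $A+B=\{a+b : a\in A,\ b\in B\}$. Here $|\cdot|$ denotes cardinality. *)

theory Defs
  imports "HOL-Algebra.AbelCoset"
begin

text \<open>
  Abelian groups are written additively through the \<^locale>\<open>abelian_group\<close> locale; it constrains
  only the additive part of the ring record, the multiplicative part being arbitrary.
\<close>

locale torsion_free_abelian_group = abelian_group G for G (structure) +
  assumes torsion_free:
    "\<lbrakk>x \<in> carrier G; (n :: nat) > 0; [n] \<cdot> x = \<zero>\<rbrakk> \<Longrightarrow> x = \<zero>"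

definition dilate :: "[('a, 'm) ring_scheme, int, 'a set] \<Rightarrow> 'a set" where
  "dilate G k X = {[k] \<cdot>\<^bsub>G\<^esub> x | x. x \<in> X}"

end

theory Submission
  imports Defs Complex_Main "HOL-Library.Set_Algebras"
begin

text \<open>
  The bound is first reduced to sets of rationals. In a torsion-free abelian group every non-zero
  element is detected by some homomorphism to \<open>\<rat>\<close>, because \<open>\<rat>\<close> is divisible
  (\<open>additive_map_nonzero\<close>), and a generic combination of finitely many such homomorphisms is
  injective on a given finite set \<open>X\<close> (\<open>additive_map_inj_on_finite\<close>). A homomorphism maps
  \<open>k \<cdot> X + l \<cdot> X\<close> onto the same expression formed from the image of \<open>X\<close>, so the sumset can
  only shrink while \<open>|X|\<close> is kept. Clearing denominators then leaves the case of a finite set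
  \<open>A\<close> of integers.

  For integers let \<open>|k| > |l|\<close> and \<open>|A| > 1\<close>, fix \<open>a\<^sub>0 \<in> A\<close> and let \<open>g\<close> be the gcd of the
  differences \<open>a - a\<^sub>0\<close>. Modulo \<open>k g\<close> the set \<open>k \<cdot> A\<close> is a single residue, whereas
  \<open>l \<cdot> A\<close> is not: otherwise \<open>k g\<close> would divide \<open>l g\<close>, contrary to \<open>0 < |l| < |k|\<close>.
  Hence \<open>A\<close> splits into two non-empty parts \<open>A\<^sub>0\<close> and \<open>A\<^sub>1\<close> such that
  \<open>k \<cdot> A + l \<cdot> A\<^sub>0\<close> and \<open>k \<cdot> A + l \<cdot> A\<^sub>1\<close> are disjoint, and applying
  \<open>|B + C| \<ge> |B| + |C| - 1\<close> to each gives
  \<open>(|A| + |A\<^sub>0| - 1) + (|A| + |A\<^sub>1| - 1) = 3 |A| - 2\<close>.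
\<close>

section \<open>Sums of dilates of sets of integers\<close>

text \<open>
  Adding \<open>Min B\<close> to all of \<open>A\<close> and then \<open>Max A\<close> to all of \<open>B\<close> walks through \<open>A + B\<close> in
  increasing order; the two translates share only the turning point \<open>Max A + Min B\<close>.
\<close>
lemma finite_set_plus_card_ge:
  fixes A B :: "'a::linordered_ab_group_add set"
  assumes "finite A" "finite B" "A \<noteq> {}" "B \<noteq> {}"
  shows "card A + card B \<le> card (A + B) + 1"
proof -
  let ?C = "(\<lambda>a. a + Min B) ` A" and ?D = "(\<lambda>b. Max A + b) ` B"
  have "?C \<inter> ?D \<subseteq> {Max A + Min B}"
  proof
    fix x assume "x \<in> ?C \<inter> ?D"
    then obtain a b where x: "a \<in> A" "b \<in> B" "x = a + Min B" "x = Max A + b" by blast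
    have "a \<le> Max A" "Min B \<le> b" using x assms by auto
    then show "x \<in> {Max A + Min B}" using x add_mono[of a "Max A" "Min B" b]
      by (metis add_left_mono add_right_mono antisym insert_iff)
  qed
  then have "card (?C \<inter> ?D) \<le> 1"
    using card_mono[of "{Max A + Min B}" "?C \<inter> ?D"] by simp
  moreover have "card ?C = card A" "card ?D = card B"
    by (auto intro!: card_image simp: inj_on_def)
  moreover have "card ?C + card ?D = card (?C \<union> ?D) + card (?C \<inter> ?D)"
    using assms by (intro card_Un_Int) auto
  moreover have "card (?C \<union> ?D) \<le> card (A + B)"
    using assms by (intro card_mono finite_set_plus) (auto intro!: set_plus_intro Min_in Max_in)
  ultimately show ?thesis by linarith
qed

text \<open>
  The gain over the trivial bound \<open>2 |A| - 1\<close> comes from splitting the second summand by its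
  residue modulo \<open>k g\<close>, where \<open>g\<close> generates the group spanned by the differences of \<open>A\<close>.
  All of \<open>k \<cdot> A\<close> is congruent modulo \<open>k g\<close>, while \<open>l \<cdot> A\<close> is not unless \<open>A\<close> is a
  singleton, because \<open>g\<close> is the largest common divisor of the differences and \<open>k\<close> does not
  divide \<open>l\<close>.
\<close>
lemma card_sum_dilates_int_less:
  fixes A :: "int set"
  assumes A: "finite A" "A \<noteq> {}" and kl: "l \<noteq> 0" "\<bar>l\<bar> < \<bar>k\<bar>"
  shows "3 * card A \<le> card ((*) k ` A + (*) l ` A) + 2"
proof (cases "\<exists>a. A = {a}")
  case True
  then obtain a where "A = {a}" ..
  moreover have "(*) k ` {a} + (*) l ` {a} = {k * a + l * a}"
    by (auto simp: set_plus_def)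
  ultimately show ?thesis by simp
next
  case False
  obtain a0 where a0: "a0 \<in> A" using A by blast
  define g where "g = Gcd ((\<lambda>a. a - a0) ` A)"
  have g_dvd: "g dvd a - a0" if "a \<in> A" for a
    using that by (auto simp: g_def)
  have "g \<noteq> 0"
  proof
    assume "g = 0"
    then have "\<forall>a\<in>A. a = a0" using g_dvd by fastforce
    then show False using False a0 by blast
  qed
  \<comment> \<open>The elements whose \<open>l\<close>-multiple is congruent to \<open>l * a0\<close> modulo \<open>k * g\<close>; all other
    classes are lumped together in \<open>A1\<close>, since two parts already give the constant \<open>3\<close>.\<close>
  define A0 where "A0 = {a \<in> A. k * g dvd l * (a - a0)}"
  define A1 where "A1 = A - A0"
  have "A1 \<noteq> {}"
  proof
    assume "A1 = {}"
    then have "k * g dvd l * (a - a0)" if "a \<in> A" for a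
      using that by (auto simp: A1_def A0_def)
    then have "k * g dvd Gcd ((*) l ` (\<lambda>a. a - a0) ` A)"
      by (auto intro!: Gcd_greatest)
    then have "k * g dvd l * g" by (simp add: Gcd_mult g_def)
    then have "k dvd l" using \<open>g \<noteq> 0\<close> by simp
    then show False using kl dvd_imp_le_int[of l k] by auto
  qed
  moreover have "A0 \<noteq> {}" using a0 by (auto simp: A0_def)
  moreover have fin: "finite A0" "finite A1" using A by (auto simp: A0_def A1_def)
  moreover have "k \<noteq> 0" using kl by auto
  ultimately have
    "card ((*) k ` A) + card ((*) l ` A0) \<le> card ((*) k ` A + (*) l ` A0) + 1"
    "card ((*) k ` A) + card ((*) l ` A1) \<le> card ((*) k ` A + (*) l ` A1) + 1"
    using A by (intro finite_set_plus_card_ge; simp)+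
  moreover have "card ((*) k ` A) = card A" "card ((*) l ` A0) = card A0" "card ((*) l ` A1) = card A1"
    using kl \<open>k \<noteq> 0\<close> by (auto intro!: card_image simp: inj_on_def)
  moreover have "card A = card A0 + card A1"
    using A by (auto simp: A1_def A0_def card_Diff_subset card_mono)
  moreover have "((*) k ` A + (*) l ` A0) \<inter> ((*) k ` A + (*) l ` A1) = {}"
  proof -
    have False if "a \<in> A" "b \<in> A0" "c \<in> A" "d \<in> A1" "k * a + l * b = k * c + l * d" for a b c d
    proof -
      have "g dvd a - c" using g_dvd[OF that(1)] g_dvd[OF that(3)]
        by (metis diff_diff_eq2 diff_add_cancel dvd_diff)
      then have "k * g dvd k * (a - c)" by simp
      moreover have "k * g dvd l * (b - a0)" using that by (simp add: A0_def)
      ultimately have "k * g dvd k * (a - c) + l * (b - a0)" by (rule dvd_add)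
      also have "k * (a - c) + l * (b - a0) = l * (d - a0)"
        using that(5) by (simp add: algebra_simps)
      finally show False using that(4) by (simp add: A0_def A1_def)
    qed
    then show ?thesis by (auto simp: set_plus_def)
  qed
  then have "card ((*) k ` A + (*) l ` A0) + card ((*) k ` A + (*) l ` A1)
    = card (((*) k ` A + (*) l ` A0) \<union> ((*) k ` A + (*) l ` A1))"
    using A fin by (intro card_Un_disjoint[symmetric] finite_set_plus) auto
  moreover have "\<dots> \<le> card ((*) k ` A + (*) l ` A)"
    using A by (intro card_mono finite_set_plus) (auto simp: A0_def A1_def set_plus_def)
  ultimately show ?thesis by linarith
qed

lemma card_sum_dilates_int:
  fixes A :: "int set"
  assumes "finite A" "A \<noteq> {}" "k \<noteq> 0" "l \<noteq> 0" "\<bar>k\<bar> \<noteq> \<bar>l\<bar>"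
  shows "3 * card A \<le> card ((*) k ` A + (*) l ` A) + 2"
proof (cases "\<bar>l\<bar> < \<bar>k\<bar>")
  case True
  then show ?thesis using assms card_sum_dilates_int_less by blast
next
  case False
  then show ?thesis using assms card_sum_dilates_int_less[of A k l]
    by (simp add: add.commute)
qed

lemma common_denominator:
  fixes A :: "rat set"
  assumes "finite A"
  shows "\<exists>N::int. N > 0 \<and> (\<forall>a\<in>A. of_int N * a \<in> \<int>)"
  using assms
proof (induction A)
  case empty
  then show ?case by (auto intro!: exI[of _ 1])
next
  case (insert a A)
  then obtain N :: int where N: "N > 0" "\<forall>a\<in>A. of_int N * a \<in> \<int>" by auto
  obtain p q where a: "a = Rat.Fract p q" "q > 0" by (cases a) auto
  have "of_int (q * N) * a = of_int (N * p)"
    using a by (simp add: Fract_of_int_quotient)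
  then have "of_int (q * N) * a \<in> \<int>" by (metis Ints_of_int)
  moreover have "of_int (q * N) * b \<in> \<int>" if "b \<in> A" for b
    using N that Ints_mult[OF Ints_of_int[of q], of "of_int N * b"] by (simp add: mult.assoc)
  ultimately show ?case using N a by (intro exI[of _ "q * N"]) auto
qed

text \<open>
  A common denominator \<open>N\<close> turns \<open>A\<close> into a set of integers. The scaling map is written with a
  floor only to make it integer-valued; at the rationals considered here nothing is rounded.
\<close>
lemma card_sum_dilates_rat:
  fixes A :: "rat set"
  assumes A: "finite A" "A \<noteq> {}" and kl: "k \<noteq> 0" "l \<noteq> 0" "\<bar>k\<bar> \<noteq> \<bar>l\<bar>"
  shows "3 * card A \<le> card ((*) (of_int k) ` A + (*) (of_int l) ` A) + 2"
proof -
  obtain N :: int where N: "N > 0" "\<forall>a\<in>A. of_int N * a \<in> \<int>"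
    using common_denominator[OF A(1)] by blast
  define h where "h q = \<lfloor>of_int N * q\<rfloor>" for q :: rat
  have h: "of_int (h a) = of_int N * a" if "a \<in> A" for a
    using N that by (simp add: h_def of_int_floor)
  have "inj_on h A"
    by (rule inj_onI) (use h N in \<open>metis mult_cancel_left of_int_eq_0_iff less_irrefl\<close>)
  have h_comb: "h (of_int k * a + of_int l * b) = k * h a + l * h b" if "a \<in> A" "b \<in> A" for a b
  proof -
    have "of_int N * (of_int k * a + of_int l * b) = of_int k * (of_int N * a) + of_int l * (of_int N * b)"
      by (simp add: algebra_simps)
    also have "\<dots> = of_int (k * h a + l * h b)" using h that by simp
    finally show ?thesis unfolding h_def[of "of_int k * a + of_int l * b"] by (simp only: floor_of_int)
  qed
  have "(*) k ` h ` A + (*) l ` h ` A \<subseteq> h ` ((*) (of_int k) ` A + (*) (of_int l) ` A)"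
  proof
    fix x assume "x \<in> (*) k ` h ` A + (*) l ` h ` A"
    then obtain a b where "a \<in> A" "b \<in> A" "x = k * h a + l * h b"
      by (auto simp: set_plus_def)
    then have "x = h (of_int k * a + of_int l * b)" "a \<in> A" "b \<in> A" using h_comb by auto
    then show "x \<in> h ` ((*) (of_int k) ` A + (*) (of_int l) ` A)" by blast
  qed
  then have "card ((*) k ` h ` A + (*) l ` h ` A) \<le> card ((*) (of_int k) ` A + (*) (of_int l) ` A)"
    using A by (intro surj_card_le finite_set_plus) auto
  moreover have "card (h ` A) = card A" using \<open>inj_on h A\<close> by (rule card_image)
  ultimately show ?thesis
    using card_sum_dilates_int[of "h ` A" k l] A kl by simp
qed

section \<open>Rational-valued homomorphisms on a torsion-free abelian group\<close>

definition (in abelian_group) additive_map :: "('a \<Rightarrow> rat) \<Rightarrow> bool" where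
  "additive_map f \<longleftrightarrow> (\<forall>x\<in>carrier G. \<forall>y\<in>carrier G. f (x \<oplus> y) = f x + f y)"

text \<open>
  A homomorphism from a subgroup of \<open>G\<close> to \<open>\<rat>\<close> is encoded by its graph, so that extension of
  homomorphisms is inclusion of sets and Zorn's lemma applies directly. Closure under subtraction
  makes a non-empty graph a subgroup of \<open>G \<times> \<rat>\<close>, and for a subgroup being single-valued need only
  be required at \<open>\<zero>\<close>.
\<close>
definition (in abelian_group) partial_hom :: "('a \<times> rat) set \<Rightarrow> bool" where
  "partial_hom \<Gamma> \<longleftrightarrow> \<Gamma> \<subseteq> carrier G \<times> UNIV
    \<and> (\<forall>x p y q. (x, p) \<in> \<Gamma> \<longrightarrow> (y, q) \<in> \<Gamma> \<longrightarrow> (x \<ominus> y, p - q) \<in> \<Gamma>)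
    \<and> (\<forall>p. (\<zero>, p) \<in> \<Gamma> \<longrightarrow> p = 0)"

context abelian_group
begin

context
  fixes \<Gamma> assumes \<Gamma>: "partial_hom \<Gamma>"
begin

lemma partial_hom_carrier: "(x, p) \<in> \<Gamma> \<Longrightarrow> x \<in> carrier G"
  using \<Gamma> by (auto simp: partial_hom_def)

lemma partial_hom_diff: "(x, p) \<in> \<Gamma> \<Longrightarrow> (y, q) \<in> \<Gamma> \<Longrightarrow> (x \<ominus> y, p - q) \<in> \<Gamma>"
  using \<Gamma> by (auto simp: partial_hom_def)

lemma partial_hom_zero: "(\<zero>, p) \<in> \<Gamma> \<Longrightarrow> p = 0"
  using \<Gamma> by (auto simp: partial_hom_def)

lemma partial_hom_unique: "(x, p) \<in> \<Gamma> \<Longrightarrow> (x, q) \<in> \<Gamma> \<Longrightarrow> p = q"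
  using partial_hom_diff[of x p x q] partial_hom_zero[of "p - q"] partial_hom_carrier[of x p]
  by (simp add: r_neg minus_eq)

lemma partial_hom_minus: "(x, p) \<in> \<Gamma> \<Longrightarrow> (\<ominus> x, - p) \<in> \<Gamma>"
  using partial_hom_diff[of x p x p] partial_hom_diff[of \<zero> 0 x p] partial_hom_carrier[of x p]
  by (simp add: r_neg minus_eq)

lemma partial_hom_add: "(x, p) \<in> \<Gamma> \<Longrightarrow> (y, q) \<in> \<Gamma> \<Longrightarrow> (x \<oplus> y, p + q) \<in> \<Gamma>"
  using partial_hom_diff[of x p "\<ominus> y" "- q"] partial_hom_minus[of y q] partial_hom_carrier[of y q]
  by (simp add: minus_eq)

lemma partial_hom_nat_multiple:
  assumes "(x, p) \<in> \<Gamma>"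
  shows "([(n::nat)] \<cdot> x, of_nat n * p) \<in> \<Gamma>"
proof (induction n)
  case 0
  then show ?case using partial_hom_diff[OF assms assms] partial_hom_carrier[OF assms]
    by (simp add: r_neg minus_eq)
next
  case (Suc n)
  then show ?case using partial_hom_add[OF Suc assms] by (simp add: algebra_simps)
qed

lemma partial_hom_int_multiple:
  assumes "(x, p) \<in> \<Gamma>"
  shows "([(n::int)] \<cdot> x, of_int n * p) \<in> \<Gamma>"
proof (cases n)
  case (nonneg m)
  then show ?thesis using partial_hom_nat_multiple[OF assms, of m]
    by (simp add: add_pow_int_ge)
next
  case (neg m)
  have "[n] \<cdot> x = \<ominus> ([Suc m] \<cdot> x)" using neg by (simp add: add_pow_int_lt nat_add_distrib)
  moreover have "of_int n * p = - (of_nat (Suc m) * p)" using neg by (simp del: of_nat_Suc)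
  ultimately show ?thesis
    using partial_hom_minus[OF partial_hom_nat_multiple[OF assms, of "Suc m"]] by metis
qed

end

text \<open>
  The homomorphism \<open>n s \<mapsto> n\<close> on the cyclic group generated by \<open>s\<close>, well defined because \<open>s\<close>
  has infinite order; it is the starting point for Zorn's lemma.
\<close>
lemma partial_hom_graph_multiples:
  assumes s: "s \<in> carrier G" and torsion_free: "\<And>n::nat. n > 0 \<Longrightarrow> [n] \<cdot> s \<noteq> \<zero>"
  shows "partial_hom (range (\<lambda>n::int. ([n] \<cdot> s, of_int n)))"
proof -
  have "n = 0" if "[n] \<cdot> s = \<zero>" for n :: int
  proof (cases n "0::int" rule: linorder_cases)
    case less
    then have "[nat (- n)] \<cdot> s = \<zero>" using that s
      by (simp add: add_pow_int_lt)
    then show ?thesis using torsion_free[of "nat (- n)"] less by simp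
  next
    case greater
    then show ?thesis using that torsion_free[of "nat n"] by (simp add: add_pow_int_ge)
  qed
  moreover have "\<exists>k::int. [n] \<cdot> s \<ominus> [m] \<cdot> s = [k] \<cdot> s \<and> of_int n - of_int m = (of_int k :: rat)" for n m :: int
    using add.int_pow_diff[OF s, of n m] by (intro exI[of _ "n - m"]) (simp add: minus_eq)
  ultimately show ?thesis using s
    by (auto simp: partial_hom_def image_iff)
qed

text \<open>
  This is where divisibility of \<open>\<rat>\<close> enters. If some multiple \<open>m g\<close> with \<open>m \<noteq> 0\<close> already has a
  value \<open>c\<close>, then \<open>g\<close> must be sent to \<open>c / m\<close>, and this is consistent for all multiples of
  \<open>g\<close> in the domain since \<open>m n g\<close> can be evaluated in two ways. If there is no such multiple,
  any value will do.
\<close>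
lemma partial_hom_extend:
  assumes \<Gamma>: "partial_hom \<Gamma>" and ne: "\<Gamma> \<noteq> {}" and g: "g \<in> carrier G"
  obtains q \<Gamma>' where "partial_hom \<Gamma>'" "\<Gamma> \<subseteq> \<Gamma>'" "(g, q) \<in> \<Gamma>'"
proof -
  have zero: "(\<zero>, 0) \<in> \<Gamma>"
  proof -
    obtain x p where "(x, p) \<in> \<Gamma>" using ne by auto
    then show ?thesis using partial_hom_diff[OF \<Gamma>, of x p x p] partial_hom_carrier[OF \<Gamma>, of x p]
      by (simp add: r_neg minus_eq)
  qed
  have "\<exists>q. \<forall>n::int. \<forall>b. ([n] \<cdot> g, b) \<in> \<Gamma> \<longrightarrow> b = of_int n * q"
  proof (cases "\<exists>m::int. \<exists>c. m \<noteq> 0 \<and> ([m] \<cdot> g, c) \<in> \<Gamma>")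
    case True
    then obtain m :: int and c where m: "m \<noteq> 0" "([m] \<cdot> g, c) \<in> \<Gamma>" by blast
    have "b = of_int n * (c / of_int m)" if "([n] \<cdot> g, b) \<in> \<Gamma>" for n :: int and b
    proof -
      have "([m] \<cdot> ([n] \<cdot> g), of_int m * b) \<in> \<Gamma>" "([n] \<cdot> ([m] \<cdot> g), of_int n * c) \<in> \<Gamma>"
        using partial_hom_int_multiple[OF \<Gamma>] m that by blast+
      moreover have "[m] \<cdot> ([n] \<cdot> g) = [n] \<cdot> ([m] \<cdot> g)"
        using g by (simp add: add.int_pow_pow mult.commute)
      ultimately have "of_int m * b = of_int n * c"
        using partial_hom_unique[OF \<Gamma>] by metis
      then show ?thesis using m by (simp add: field_simps)
    qed
    then show ?thesis by blast
  next
    case False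
    then have "b = of_int n * 0" if "([n] \<cdot> g, b) \<in> \<Gamma>" for n :: int and b
      using that partial_hom_zero[OF \<Gamma>, of b] by (cases "n = 0") (auto simp: add_pow_int_ge)
    then show ?thesis by blast
  qed
  then obtain q where q: "\<And>n b. ([(n::int)] \<cdot> g, b) \<in> \<Gamma> \<Longrightarrow> b = of_int n * q" by blast
  define \<Gamma>' where "\<Gamma>' = {(a \<oplus> [n] \<cdot> g, b + of_int n * q) | a b (n::int). (a, b) \<in> \<Gamma>}"
  have "partial_hom \<Gamma>'"
    unfolding partial_hom_def
  proof (intro conjI allI impI)
    show "\<Gamma>' \<subseteq> carrier G \<times> UNIV"
      using g partial_hom_carrier[OF \<Gamma>] by (auto simp: \<Gamma>'_def)
  next
    fix x p y r assume "(x, p) \<in> \<Gamma>'" "(y, r) \<in> \<Gamma>'"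
    then obtain a b a' b' and n n' :: int where
      ab: "(a, b) \<in> \<Gamma>" "(a', b') \<in> \<Gamma>" and
      xy: "x = a \<oplus> [n] \<cdot> g" "p = b + of_int n * q" "y = a' \<oplus> [n'] \<cdot> g" "r = b' + of_int n' * q"
      unfolding \<Gamma>'_def by blast
    have "x \<ominus> y = (a \<ominus> a') \<oplus> [(n - n')] \<cdot> g"
      using ab[THEN partial_hom_carrier[OF \<Gamma>]] g
      by (simp add: xy minus_eq minus_add add.int_pow_diff a_ac)
    moreover have "p - r = (b - b') + of_int (n - n') * q" by (simp add: xy algebra_simps)
    ultimately show "(x \<ominus> y, p - r) \<in> \<Gamma>'"
      using partial_hom_diff[OF \<Gamma> ab] unfolding \<Gamma>'_def by blast
  next
    fix p assume "(\<zero>, p) \<in> \<Gamma>'"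
    then obtain a b and n :: int where
      ab: "(a, b) \<in> \<Gamma>" "a \<oplus> [n] \<cdot> g = \<zero>" "p = b + of_int n * q"
      unfolding \<Gamma>'_def by force
    have "\<ominus> a = [n] \<cdot> g"
      using ab partial_hom_carrier[OF \<Gamma> ab(1)] g by (metis add.int_pow_closed add.inv_equality a_comm add.inv_inv)
    then show "p = 0" using q[of n "- b"] partial_hom_minus[OF \<Gamma> ab(1)] ab(3) by simp
  qed
  moreover have "\<Gamma> \<subseteq> \<Gamma>'"
  proof
    fix z assume "z \<in> \<Gamma>"
    then obtain a b where "z = (a, b)" "(a, b) \<in> \<Gamma>" by (cases z) auto
    moreover have "(a, b) = (a \<oplus> [(0::int)] \<cdot> g, b + of_int 0 * q)"
      using partial_hom_carrier[OF \<Gamma> calculation(2)] by (simp add: add_pow_int_ge)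
    ultimately show "z \<in> \<Gamma>'" unfolding \<Gamma>'_def by blast
  qed
  moreover have "(g, q) \<in> \<Gamma>'"
  proof -
    have "(g, q) = (\<zero> \<oplus> [(1::int)] \<cdot> g, 0 + of_int 1 * q)" using g by simp
    then show ?thesis using zero unfolding \<Gamma>'_def by blast
  qed
  ultimately show ?thesis by (rule that)
qed

lemma partial_hom_Union_chain:
  assumes "\<And>\<Gamma>. \<Gamma> \<in> C \<Longrightarrow> partial_hom \<Gamma>" and chain: "\<And>\<Gamma> \<Delta>. \<Gamma> \<in> C \<Longrightarrow> \<Delta> \<in> C \<Longrightarrow> \<Gamma> \<subseteq> \<Delta> \<or> \<Delta> \<subseteq> \<Gamma>"
  shows "partial_hom (\<Union>C)"
  unfolding partial_hom_def
proof (intro conjI allI impI)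
  show "\<Union>C \<subseteq> carrier G \<times> UNIV"
    by (auto dest: partial_hom_carrier[OF assms(1)])
next
  fix x p y q assume "(x, p) \<in> \<Union>C" "(y, q) \<in> \<Union>C"
  then obtain \<Gamma> \<Delta> where *: "\<Gamma> \<in> C" "(x, p) \<in> \<Gamma>" "\<Delta> \<in> C" "(y, q) \<in> \<Delta>" by auto
  then obtain \<Theta> where "\<Theta> \<in> C" "(x, p) \<in> \<Theta>" "(y, q) \<in> \<Theta>"
    using chain[of \<Gamma> \<Delta>] by auto
  then show "(x \<ominus> y, p - q) \<in> \<Union>C"
    using partial_hom_diff[OF assms(1)[of \<Theta>], of x p y q] by auto
next
  fix p assume "(\<zero>, p) \<in> \<Union>C"
  then obtain \<Gamma> where "\<Gamma> \<in> C" "(\<zero>, p) \<in> \<Gamma>" by auto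
  then show "p = 0" using partial_hom_zero[OF assms(1)] by auto
qed

lemma additive_map_of_total_partial_hom:
  assumes \<Gamma>: "partial_hom \<Gamma>" and total: "\<And>x. x \<in> carrier G \<Longrightarrow> \<exists>q. (x, q) \<in> \<Gamma>"
  shows "\<exists>f. additive_map f \<and> (\<forall>x q. (x, q) \<in> \<Gamma> \<longrightarrow> f x = q)"
proof -
  define f where "f x = (THE q. (x, q) \<in> \<Gamma>)" for x
  have f: "f x = q" if "(x, q) \<in> \<Gamma>" for x q
    unfolding f_def using that by (rule the_equality) (rule partial_hom_unique[OF \<Gamma> _ that])
  have "f (x \<oplus> y) = f x + f y" if x: "x \<in> carrier G" and y: "y \<in> carrier G" for x y
  proof -
    obtain p q where "(x, p) \<in> \<Gamma>" "(y, q) \<in> \<Gamma>" using total[OF x] total[OF y] by auto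
    then show ?thesis using partial_hom_add[OF \<Gamma>, of x p y q] by (simp add: f)
  qed
  then have "additive_map f" by (simp add: additive_map_def)
  then show ?thesis using f by blast
qed

lemma additive_map_int_multiple:
  assumes f: "additive_map f" and x: "x \<in> carrier G"
  shows "f ([(n::int)] \<cdot> x) = of_int n * f x"
proof -
  have add: "f (y \<oplus> z) = f y + f z" if "y \<in> carrier G" "z \<in> carrier G" for y z
    using f that by (simp add: additive_map_def)
  have zero: "f \<zero> = 0" using add[of \<zero> \<zero>] by simp
  have neg: "f (\<ominus> y) = - f y" if "y \<in> carrier G" for y
    using add[of y "\<ominus> y"] that zero by (simp add: r_neg add_eq_0_iff)
  have nat: "f ([(m::nat)] \<cdot> x) = of_nat m * f x" for m
    by (induction m) (use x zero add in \<open>auto simp: algebra_simps\<close>)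
  show ?thesis
  proof (cases "n \<ge> 0")
    case True
    then show ?thesis using nat[of "nat n"] by (simp add: add_pow_int_ge)
  next
    case False
    then show ?thesis using nat[of "nat (- n)"] neg[of "[nat (- n)] \<cdot> x"] x
      by (simp add: add_pow_int_lt)
  qed
qed

end

context torsion_free_abelian_group
begin

text \<open>
  A maximal partial homomorphism extending \<open>n s \<mapsto> n\<close> is defined on all of \<open>G\<close>, as otherwise
  it could be extended by one more element.
\<close>
lemma additive_map_nonzero:
  assumes s: "s \<in> carrier G" "s \<noteq> \<zero>"
  obtains f where "additive_map f" "f s \<noteq> 0"
proof -
  let ?\<A> = "{\<Gamma>. partial_hom \<Gamma> \<and> (s, 1) \<in> \<Gamma>}"
  have "partial_hom (range (\<lambda>n::int. ([n] \<cdot> s, of_int n)))"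
    by (rule partial_hom_graph_multiples[OF s(1)]) (use torsion_free s in blast)
  moreover have "(s, 1) = ([(1::int)] \<cdot> s, of_int 1)" using s by simp
  then have "(s, 1) \<in> range (\<lambda>n::int. ([n] \<cdot> s, of_int n))" by (rule range_eqI)
  ultimately have "range (\<lambda>n::int. ([n] \<cdot> s, of_int n)) \<in> ?\<A>" by simp
  then have "?\<A> \<noteq> {}" by blast
  moreover have "\<Union>C \<in> ?\<A>" if "C \<noteq> {}" "subset.chain ?\<A> C" for C
  proof -
    have "partial_hom (\<Union>C)"
      using that by (intro partial_hom_Union_chain) (auto simp: subset.chain_def)
    then show ?thesis using that by (auto simp: subset.chain_def)
  qed
  ultimately obtain \<Gamma> where "\<Gamma> \<in> ?\<A>" and max: "\<forall>\<Delta>\<in>?\<A>. \<Gamma> \<subseteq> \<Delta> \<longrightarrow> \<Delta> = \<Gamma>"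
    using subset_Zorn_nonempty[of ?\<A>] by blast
  then have \<Gamma>: "partial_hom \<Gamma>" "(s, 1) \<in> \<Gamma>" by auto
  have total: "\<exists>q. (x, q) \<in> \<Gamma>" if x: "x \<in> carrier G" for x
  proof -
    obtain q \<Delta> where "partial_hom \<Delta>" "\<Gamma> \<subseteq> \<Delta>" "(x, q) \<in> \<Delta>"
      using \<Gamma>(2) by (auto intro: partial_hom_extend[OF \<Gamma>(1) _ x])
    moreover have "\<Delta> = \<Gamma>" using max \<Gamma>(2) calculation by auto
    ultimately show ?thesis by auto
  qed
  then obtain f where "additive_map f" and f: "\<forall>x q. (x, q) \<in> \<Gamma> \<longrightarrow> f x = q"
    using additive_map_of_total_partial_hom[OF \<Gamma>(1)] by blast
  have "f s \<noteq> 0" using f \<Gamma>(2) by auto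
  with \<open>additive_map f\<close> show ?thesis by (rule that)
qed

text \<open>
  If \<open>f\<close> is non-zero on \<open>S\<close> and \<open>h\<close> at one further element \<open>s\<close>, then \<open>h + t f\<close> vanishes
  somewhere on \<open>insert s S\<close> only if \<open>t\<close> is one of finitely many ratios \<open>- h x / f x\<close>.
\<close>
lemma additive_map_nonzero_on_finite:
  assumes "finite S" "S \<subseteq> carrier G" "\<zero> \<notin> S"
  shows "\<exists>f. additive_map f \<and> (\<forall>s\<in>S. f s \<noteq> 0)"
  using assms
proof (induction S)
  case empty
  have "additive_map (\<lambda>_. 0)" by (simp add: additive_map_def)
  then show ?case by blast
next
  case (insert s S)
  then obtain f where f: "additive_map f" "\<forall>x\<in>S. f x \<noteq> 0" by auto
  obtain h where h: "additive_map h" "h s \<noteq> 0" using additive_map_nonzero[of s] insert.prems by auto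
  have "finite ((\<lambda>x. - h x / f x) ` insert s S)" using insert.hyps by simp
  then obtain t where t: "t \<notin> (\<lambda>x. - h x / f x) ` insert s S"
    using ex_new_if_finite[of "(\<lambda>x. - h x / f x) ` insert s S"]
    by (auto simp: infinite_UNIV_char_0)
  have "h x + t * f x \<noteq> 0" if "x \<in> insert s S" for x
  proof (cases "f x = 0")
    \<comment> \<open>Only \<open>x = s\<close> is possible here, and \<open>h s \<noteq> 0\<close>.\<close>
    case True
    then show ?thesis using that f h by auto
  next
    case False
    have "t \<noteq> - h x / f x" using t that by blast
    then show ?thesis using False by (simp add: field_simps add_eq_0_iff2)
  qed
  moreover have "additive_map (\<lambda>x. h x + t * f x)"
    using f h by (simp add: additive_map_def algebra_simps)
  ultimately show ?case by blast
qed

text \<open>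
  Injectivity on \<open>X\<close> amounts to not vanishing on the finitely many non-zero differences.
\<close>
lemma additive_map_inj_on_finite:
  assumes X: "finite X" "X \<subseteq> carrier G"
  obtains f where "additive_map f" "inj_on f X"
proof -
  let ?S = "(\<lambda>(x, y). x \<ominus> y) ` (X \<times> X) - {\<zero>}"
  have "finite ?S" "?S \<subseteq> carrier G" "\<zero> \<notin> ?S" using X by auto
  then obtain f where f: "additive_map f" "\<forall>s\<in>?S. f s \<noteq> 0"
    using additive_map_nonzero_on_finite[of ?S] by metis
  have "inj_on f X"
  proof (rule inj_onI, rule ccontr)
    fix x y assume xy: "x \<in> X" "y \<in> X" "f x = f y" "x \<noteq> y"
    then have G: "x \<in> carrier G" "y \<in> carrier G" using X by auto
    have split: "x = (x \<ominus> y) \<oplus> y" using G by (simp add: minus_eq a_assoc l_neg)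
    have "f ((x \<ominus> y) \<oplus> y) = f (x \<ominus> y) + f y" using f(1) G by (simp add: additive_map_def)
    then have "f (x \<ominus> y) = 0" using xy(3) split by simp
    moreover have "x \<ominus> y \<noteq> \<zero>" using split xy(4) G by (metis l_zero)
    then have "x \<ominus> y \<in> ?S" using xy(1,2) by (intro DiffI image_eqI[of _ _ "(x, y)"]) simp_all
    ultimately show False using f(2) by blast
  qed
  then show ?thesis by (rule that[OF f(1)])
qed

end

section \<open>Sums of dilates in a torsion-free abelian group\<close>

theorem theorem1:
  fixes G :: "('a, 'm) ring_scheme" and X :: "'a set" and k l :: int
  assumes "torsion_free_abelian_group G"
    and "X \<subseteq> carrier G" and "finite X" and "X \<noteq> {}"
    and "k \<noteq> 0" and "l \<noteq> 0" and "\<bar>k\<bar> \<noteq> \<bar>l\<bar>"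
  shows "int (card (dilate G k X <+>\<^bsub>G\<^esub> dilate G l X)) \<ge> 3 * int (card X) - 2"
proof -
  interpret torsion_free_abelian_group G by fact
  obtain f where f: "additive_map f" "inj_on f X"
    by (rule additive_map_inj_on_finite[OF \<open>finite X\<close> \<open>X \<subseteq> carrier G\<close>])
  let ?S = "dilate G k X <+>\<^bsub>G\<^esub> dilate G l X"
  have S: "?S = (\<lambda>(x, y). [k] \<cdot>\<^bsub>G\<^esub> x \<oplus>\<^bsub>G\<^esub> [l] \<cdot>\<^bsub>G\<^esub> y) ` (X \<times> X)"
    unfolding set_add_def' dilate_def Setcompr_eq_image by auto
  have f_comb: "f ([k] \<cdot>\<^bsub>G\<^esub> x \<oplus>\<^bsub>G\<^esub> [l] \<cdot>\<^bsub>G\<^esub> y) = of_int k * f x + of_int l * f y" if "x \<in> X" "y \<in> X" for x y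
  proof -
    have "x \<in> carrier G" "y \<in> carrier G" using that assms by auto
    then show ?thesis using f(1) additive_map_int_multiple[OF f(1)]
      by (simp add: additive_map_def)
  qed
  have "(*) (of_int k) ` f ` X + (*) (of_int l) ` f ` X \<subseteq> f ` ?S"
  proof
    fix z assume "z \<in> (*) (of_int k) ` f ` X + (*) (of_int l) ` f ` X"
    then obtain x y where xy: "x \<in> X" "y \<in> X" "z = of_int k * f x + of_int l * f y"
      by (auto simp: set_plus_def)
    then have "z = f ([k] \<cdot>\<^bsub>G\<^esub> x \<oplus>\<^bsub>G\<^esub> [l] \<cdot>\<^bsub>G\<^esub> y)" using f_comb by simp
    then show "z \<in> f ` ?S" unfolding S using xy(1,2) by auto
  qed
  moreover have "finite ?S" unfolding S using assms by simp
  ultimately have "card ((*) (of_int k) ` f ` X + (*) (of_int l) ` f ` X) \<le> card ?S"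
    by (intro surj_card_le)
  moreover have "card (f ` X) = card X" using f by (simp add: card_image)
  ultimately show ?thesis using card_sum_dilates_rat[of "f ` X" k l] assms by simp
qed

end
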